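(* Let $R$ be the racetrack space, i.e. $R=\mathbb{R}^2$ equipped with the norm $$\|(x_1,x_2)\|_R=\begin{cases}|x_2|,&|x_2|\geq|x_1|,\\ \frac{x_1^2+x_2^2}{2|x_1|},&\text{otherwise.}\end{cases}$$ Then $\mathrm{mr}(R)>1$ and $\mathrm{mr}(R^* )=1$. In particular, $\mathrm{mr}(R)\neq\mathrm{mr}(R^* )$.
   Context: The formula above defines a norm on $\mathbb{R}^2$. $R^*$ is the dual Banach space of $R$; under the standard pairing it is $\mathbb{R}^2$ with the norm $\|(x_1,x_2)\|_{R^*}=\sqrt{x_1^2+x_2^2}+|x_1|$. A metric space $(X,d)$ has roundness $p\geq 1$ if for all $a_1,a_2,b_1,b_2\in X$, $d(a_1,a_2)^p+d(b_1,b_2)^p\leq\sum_{1\leq i,j\leq 2}d(a_i,b_j)^p$. For a Banach space $X$ this is equivalent (Enflo) to $\|x+y\|^p+\|x-y\|^p\leq 2(\|x\|^p+\|y\|^p)$ for all $x,y\in X$. The maximal roundness of $X$ is $\mathrm{mr}(X)=\sup\{p\geq 1: X\text{ has roundness }p\}$. *)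

theory Defs
  imports "HOL-Analysis.Analysis"
begin

section \<open>Roundness and maximal roundness of metric spaces\<close>

definition has_roundness :: "'a::metric_space itself \<Rightarrow> real \<Rightarrow> bool" where
  "has_roundness T p \<longleftrightarrow> 1 \<le> p \<and>
     (\<forall>a1 a2 b1 b2 :: 'a.
        dist a1 a2 powr p + dist b1 b2 powr p
          \<le> dist a1 b1 powr p + dist a1 b2 powr p + dist a2 b1 powr p + dist a2 b2 powr p)"

text \<open>The supremum is taken in the extended reals because the set of exponents may be unbounded
  (as for ultrametric spaces). It is never empty: the exponent 1 always belongs to it.\<close>

definition max_roundness :: "'a::metric_space itself \<Rightarrow> ereal" where
  "max_roundness T = (SUP p \<in> {p. has_roundness T p}. ereal p)"


section \<open>The racetrack space\<close>

text \<open>A copy of the vector space \<open>real ^ 2\<close>, carrying the racetrack norm instead of the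
  Euclidean one.\<close>

typedef racetrack = "UNIV :: (real ^ 2) set"
  morphisms coords of_coords by simp

setup_lifting type_definition_racetrack

instantiation racetrack :: real_vector
begin
lift_definition zero_racetrack :: racetrack is 0 .
lift_definition plus_racetrack :: "racetrack \<Rightarrow> racetrack \<Rightarrow> racetrack" is "(+)" .
lift_definition minus_racetrack :: "racetrack \<Rightarrow> racetrack \<Rightarrow> racetrack" is "(-)" .
lift_definition uminus_racetrack :: "racetrack \<Rightarrow> racetrack" is uminus .
lift_definition scaleR_racetrack :: "real \<Rightarrow> racetrack \<Rightarrow> racetrack" is "(*\<^sub>R)" .
instance
  by standard (transfer; simp add: algebra_simps)+
end

definition racetrack_norm :: "real \<Rightarrow> real \<Rightarrow> real" where
  "racetrack_norm x1 x2 =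
     (if \<bar>x2\<bar> \<ge> \<bar>x1\<bar> then \<bar>x2\<bar> else (x1\<^sup>2 + x2\<^sup>2) / (2 * \<bar>x1\<bar>))"

text \<open>The unit ball is a stadium, the Minkowski sum of \<open>[-1, 1] \<times> {0}\<close> and the Euclidean unit
  disc; its convexity gives the triangle inequality.\<close>

lemma racetrack_norm_nonneg: "racetrack_norm x y \<ge> 0"
  by (simp add: racetrack_norm_def)

lemma racetrack_norm_witness:
  "\<exists>s. \<bar>s\<bar> \<le> racetrack_norm x y \<and> sqrt ((x - s)\<^sup>2 + y\<^sup>2) \<le> racetrack_norm x y"
proof (cases "\<bar>y\<bar> \<ge> \<bar>x\<bar>")
  case True
  then show ?thesis
    by (intro exI[of _ x]) (simp add: racetrack_norm_def)
next
  case False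
  define t where "t = racetrack_norm x y"
  have t: "t = (x\<^sup>2 + y\<^sup>2) / (2 * \<bar>x\<bar>)" "t \<ge> 0"
    using False racetrack_norm_nonneg by (auto simp: t_def racetrack_norm_def)
  have xt: "x\<^sup>2 + y\<^sup>2 = 2 * \<bar>x\<bar> * t"
    using False t by (simp add: field_simps)
  have "(x - sgn x * t)\<^sup>2 + y\<^sup>2 = x\<^sup>2 + y\<^sup>2 - 2 * (x * sgn x) * t + (sgn x)\<^sup>2 * t\<^sup>2"
    by (simp add: power2_eq_square algebra_simps)
  also have "\<dots> = t\<^sup>2"
    using False xt by (auto simp: sgn_if abs_if)
  finally have "sqrt ((x - sgn x * t)\<^sup>2 + y\<^sup>2) = t"
    using t by simp
  then show ?thesis
    using t by (intro exI[of _ "sgn x * t"]) (auto simp: t_def[symmetric] abs_mult sgn_if)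
qed

lemma racetrack_norm_leI:
  assumes s: "\<bar>s\<bar> \<le> t" and d: "sqrt ((x - s)\<^sup>2 + y\<^sup>2) \<le> t"
  shows "racetrack_norm x y \<le> t"
proof -
  have t0: "t \<ge> 0" using s by linarith
  have sq: "(x - s)\<^sup>2 + y\<^sup>2 \<le> t\<^sup>2" using d t0 by (simp add: sqrt_le_D)
  show ?thesis
  proof (cases "\<bar>y\<bar> \<ge> \<bar>x\<bar>")
    case True
    have "y\<^sup>2 \<le> t\<^sup>2" using sq zero_le_power2[of "x - s"] by linarith
    then show ?thesis using True t0 by (simp add: racetrack_norm_def abs_le_square_iff[symmetric])
  next
    case False
    have "x\<^sup>2 + y\<^sup>2 \<le> 2 * \<bar>x\<bar> * t"
    proof (cases "t \<ge> \<bar>x\<bar>")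
      case True
      have "y\<^sup>2 \<le> x\<^sup>2" using False by (simp add: abs_le_square_iff[symmetric])
      moreover have "\<bar>x\<bar> * \<bar>x\<bar> \<le> \<bar>x\<bar> * t" using True by (intro mult_left_mono) auto
      ultimately show ?thesis by (simp add: power2_eq_square)
    next
      case tx: False
      have "x * s \<le> \<bar>x\<bar> * \<bar>s\<bar>" by (metis abs_ge_self abs_mult)
      moreover have "0 \<le> (t - \<bar>s\<bar>) * (2 * \<bar>x\<bar> - t - \<bar>s\<bar>)"
        using tx s by (intro mult_nonneg_nonneg) linarith+
      ultimately show ?thesis
        using sq by (simp add: power2_eq_square algebra_simps)
    qed
    then show ?thesis using False by (simp add: racetrack_norm_def field_simps)
  qed
qed

lemma racetrack_norm_triangle:
  "racetrack_norm (x + x') (y + y') \<le> racetrack_norm x y + racetrack_norm x' y'"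
proof -
  obtain s where s: "\<bar>s\<bar> \<le> racetrack_norm x y" "sqrt ((x - s)\<^sup>2 + y\<^sup>2) \<le> racetrack_norm x y"
    using racetrack_norm_witness by blast
  obtain s' where s': "\<bar>s'\<bar> \<le> racetrack_norm x' y'"
      "sqrt ((x' - s')\<^sup>2 + y'\<^sup>2) \<le> racetrack_norm x' y'"
    using racetrack_norm_witness by blast
  have "sqrt (((x - s) + (x' - s'))\<^sup>2 + (y + y')\<^sup>2)
          \<le> sqrt ((x - s)\<^sup>2 + y\<^sup>2) + sqrt ((x' - s')\<^sup>2 + y'\<^sup>2)"
    by (rule real_sqrt_sum_squares_triangle_ineq)
  moreover have "(x - s) + (x' - s') = x + x' - (s + s')" by simp
  ultimately have "sqrt ((x + x' - (s + s'))\<^sup>2 + (y + y')\<^sup>2)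
      \<le> racetrack_norm x y + racetrack_norm x' y'"
    using s s' by simp
  moreover have "\<bar>s + s'\<bar> \<le> racetrack_norm x y + racetrack_norm x' y'"
    using s s' by linarith
  ultimately show ?thesis by (intro racetrack_norm_leI)
qed

lemma racetrack_norm_scale: "racetrack_norm (a * x) (a * y) = \<bar>a\<bar> * racetrack_norm x y"
proof (cases "a = 0")
  case False
  have "(a * x)\<^sup>2 + (a * y)\<^sup>2 = \<bar>a\<bar> * (\<bar>a\<bar> * (x\<^sup>2 + y\<^sup>2))"
    by (simp add: power_mult_distrib distrib_left power2_eq_square flip: mult.assoc)
  then have "((a * x)\<^sup>2 + (a * y)\<^sup>2) / (2 * \<bar>a * x\<bar>) = \<bar>a\<bar> * ((x\<^sup>2 + y\<^sup>2) / (2 * \<bar>x\<bar>))"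
    using False by (simp add: abs_mult)
  with False show ?thesis by (simp add: racetrack_norm_def abs_mult)
qed (simp add: racetrack_norm_def)

lemma racetrack_norm_eq_0_iff: "racetrack_norm x y = 0 \<longleftrightarrow> x = 0 \<and> y = 0"
  by (auto simp: racetrack_norm_def sum_power2_eq_zero_iff)

instantiation racetrack :: real_normed_vector
begin

lift_definition norm_racetrack :: "racetrack \<Rightarrow> real" is "\<lambda>x. racetrack_norm (x $ 1) (x $ 2)" .

definition dist_racetrack :: "racetrack \<Rightarrow> racetrack \<Rightarrow> real" where
  "dist_racetrack x y = norm (x - y)"

definition sgn_racetrack :: "racetrack \<Rightarrow> racetrack" where
  "sgn_racetrack x = x /\<^sub>R norm x"

definition uniformity_racetrack :: "(racetrack \<times> racetrack) filter" where
  "uniformity_racetrack = (INF e\<in>{0 <..}. principal {(x, y). dist x y < e})"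

definition open_racetrack :: "racetrack set \<Rightarrow> bool" where
  "open_racetrack U \<longleftrightarrow> (\<forall>x\<in>U. eventually (\<lambda>(x', y). x' = x \<longrightarrow> y \<in> U) uniformity)"

instance
proof
  fix x y :: racetrack and a :: real
  show "norm x = 0 \<longleftrightarrow> x = 0"
    by transfer (simp add: racetrack_norm_eq_0_iff vec_eq_iff forall_2)
  show "norm (x + y) \<le> norm x + norm y"
    by transfer (simp add: racetrack_norm_triangle)
  show "norm (a *\<^sub>R x) = \<bar>a\<bar> * norm x"
    by transfer (simp add: racetrack_norm_scale)
qed (simp_all only: dist_racetrack_def sgn_racetrack_def uniformity_racetrack_def open_racetrack_def)

end

lemma norm_racetrack_le: "norm x \<le> norm (coords x)"
proof (transfer, rule racetrack_norm_leI[where s = 0])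
  fix x :: "real ^ 2"
  show "sqrt ((x $ 1 - 0)\<^sup>2 + (x $ 2)\<^sup>2) \<le> norm x"
    by (simp add: norm_vec_def L2_set_def sum_2)
qed simp

lemma norm_coords_le: "norm (coords x) \<le> 2 * norm x"
proof transfer
  fix x :: "real ^ 2"
  let ?t = "racetrack_norm (x $ 1) (x $ 2)"
  obtain s where s: "\<bar>s\<bar> \<le> ?t" "sqrt ((x $ 1 - s)\<^sup>2 + (x $ 2)\<^sup>2) \<le> ?t"
    using racetrack_norm_witness by blast
  have "norm x = sqrt ((x $ 1 - s + s)\<^sup>2 + (x $ 2 + 0)\<^sup>2)"
    by (simp add: norm_vec_def L2_set_def sum_2)
  also have "\<dots> \<le> sqrt ((x $ 1 - s)\<^sup>2 + (x $ 2)\<^sup>2) + sqrt (s\<^sup>2 + 0\<^sup>2)"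
    by (rule real_sqrt_sum_squares_triangle_ineq)
  finally show "norm x \<le> 2 * ?t" using s by simp
qed

instance racetrack :: banach
proof
  fix X :: "nat \<Rightarrow> racetrack"
  assume X: "Cauchy X"
  have "Cauchy (\<lambda>n. coords (X n))"
  proof (rule metric_CauchyI)
    fix e :: real assume "e > 0"
    then obtain M where M: "\<And>m n. m \<ge> M \<Longrightarrow> n \<ge> M \<Longrightarrow> dist (X m) (X n) < e / 2"
      using X metric_CauchyD[of X "e / 2"] by auto
    have "dist (coords (X m)) (coords (X n)) < e" if "m \<ge> M" "n \<ge> M" for m n
      using M[OF that] norm_coords_le[of "X m - X n"]
      by (simp add: dist_norm minus_racetrack.rep_eq)
    then show "\<exists>M. \<forall>m\<ge>M. \<forall>n\<ge>M. dist (coords (X m)) (coords (X n)) < e" by blast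
  qed
  then obtain l where l: "(\<lambda>n. coords (X n)) \<longlonglongrightarrow> l"
    using Cauchy_convergent_iff convergent_def by blast
  have "norm (norm (X n - of_coords l)) \<le> norm (coords (X n) - l)" for n
    using norm_racetrack_le[of "X n - of_coords l"]
    by (simp add: minus_racetrack.rep_eq of_coords_inverse)
  moreover have "(\<lambda>n. norm (coords (X n) - l)) \<longlonglongrightarrow> 0"
    using l by (simp add: LIM_zero tendsto_norm_zero)
  ultimately have "(\<lambda>n. norm (X n - of_coords l)) \<longlonglongrightarrow> 0"
    by (rule_tac Lim_null_comparison[where g = "\<lambda>n. norm (coords (X n) - l)"]) auto
  then have "X \<longlonglongrightarrow> of_coords l"
    by (metis LIM_zero_iff tendsto_norm_zero_iff)
  then show "convergent X" by (auto simp: convergent_def)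
qed

text \<open>The dual Banach space: bounded linear functionals with the operator norm.\<close>

type_synonym racetrack_dual = "racetrack \<Rightarrow>\<^sub>L real"

end

theory Submission
  imports Defs
begin

text \<open>
  The racetrack space has roundness above 1 because its norm is smooth, and its dual has not because
  the dual norm has a corner.

  The unit circle of the racetrack norm is made of two segments and two half circles that join
  tangentially, so the square of the norm lies below a tangent quadratic function at every point
  (\<open>racetrack_norm_quadratic_bound\<close>). Averaging over \<open>y\<close> and \<open>-y\<close> gives
  \<open>\<parallel>x + y\<parallel>\<^sup>2 + \<parallel>x - y\<parallel>\<^sup>2 \<le> 2 \<parallel>x\<parallel>\<^sup>2 + 2 C \<parallel>y\<parallel>\<^sup>2\<close>, that is, smoothness of power type 2. Every normed
  space with this property has roundness \<open>p\<close> for some \<open>p > 1\<close>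
  (\<open>two_smooth_imp_roundness_above_1\<close>). To see this, take \<open>\<parallel>x\<parallel> = 1\<close> and \<open>t = \<parallel>y\<parallel> \<le> 1\<close>. The average of
  \<open>\<parallel>x \<plusminus> y\<parallel>\<^sup>p\<close> must be at most \<open>1 + t\<^sup>p\<close>. For small \<open>t\<close> it is at most \<open>1 + C t\<^sup>2\<close>, and \<open>t\<^sup>2\<close> is
  negligible against \<open>t\<^sup>p\<close>. For \<open>t\<close> bounded away from 0 there is room already at \<open>p = 1\<close>: smoothness
  forces the average of \<open>\<parallel>x \<plusminus> y\<parallel>\<close> to be at most \<open>1 + \<kappa> t\<close> with \<open>\<kappa> < 1\<close>, and this survives a small increase
  of \<open>p\<close>.

  The dual norm grows linearly in both directions when the functional \<open>(0, 1)\<close> is moved by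
  \<open>(\<plusminus>\<epsilon>, 0)\<close>. The two diagonals of the resulting parallelogram have length at least \<open>1 + \<epsilon>\<close>, whereas
  roundness \<open>p\<close> would allow an average \<open>p\<close>-th power of at most \<open>1 + O(\<epsilon>\<^sup>p)\<close>
  (\<open>racetrack_dual_roundness_le_1\<close>).
\<close>

section \<open>Roundness in normed spaces\<close>

lemma powr_midpoint:
  fixes a b p :: real
  assumes "1 \<le> p" "0 \<le> a" "0 \<le> b"
  shows "((a + b) / 2) powr p \<le> (a powr p + b powr p) / 2"
proof -
  have half: "(c / 2) powr p \<le> c powr p / 2" if "0 \<le> c" for c :: real
  proof -
    have "(1 / 2 :: real) powr p \<le> (1 / 2) powr 1"
      using assms(1) by (intro powr_mono') auto
    then have "c powr p * (1 / 2) powr p \<le> c powr p * (1 / 2)"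
      by (intro mult_left_mono) auto
    then show ?thesis
      using that powr_mult[of c "1 / 2" p] by simp
  qed
  show ?thesis
  proof (cases "a = 0 \<or> b = 0")
    case True
    then show ?thesis using half assms by auto
  next
    case False
    then have "a \<in> {0<..}" "b \<in> {0<..}" using assms by auto
    then have "((1 - 1 / 2) *\<^sub>R a + (1 / 2) *\<^sub>R b) powr p
        \<le> (1 - 1 / 2) * a powr p + (1 / 2) * b powr p"
      by (intro convex_onD[OF powr_convex[OF assms(1)]]) auto
    then show ?thesis by (simp add: field_simps)
  qed
qed

text \<open>Enflo's reduction: the two diagonals of any quadrilateral are also the two diagonals of the
  parallelogram spanned by the averages \<open>x\<close> and \<open>y\<close> of its opposite sides, and convexity of the
  \<open>p\<close>-th power shows that averaging does not increase the right-hand side.\<close>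

lemma has_roundness_if_parallelogram:
  fixes p :: real
  assumes p: "1 \<le> p"
    and par: "\<And>x y :: 'a::real_normed_vector.
      norm (x + y) powr p + norm (x - y) powr p \<le> 2 * norm x powr p + 2 * norm y powr p"
  shows "has_roundness TYPE('a) p"
proof -
  have "dist a1 a2 powr p + dist b1 b2 powr p
      \<le> dist a1 b1 powr p + dist a1 b2 powr p + dist a2 b1 powr p + dist a2 b2 powr p"
    for a1 a2 b1 b2 :: 'a
  proof -
    have avg: "2 * norm ((1 / 2) *\<^sub>R (u + v)) powr p \<le> norm u powr p + norm v powr p" for u v :: 'a
    proof -
      have "norm ((1 / 2) *\<^sub>R (u + v)) powr p \<le> ((norm u + norm v) / 2) powr p"
        using p norm_triangle_ineq[of u v] by (intro powr_mono2) auto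
      also have "\<dots> \<le> (norm u powr p + norm v powr p) / 2"
        using p by (intro powr_midpoint) auto
      finally show ?thesis by simp
    qed
    define x where "x = (1 / 2) *\<^sub>R ((a1 - b1) + (b2 - a2))"
    define y where "y = (1 / 2) *\<^sub>R ((b1 - a2) + (a1 - b2))"
    have "((a1 - b1) + (b2 - a2)) + ((b1 - a2) + (a1 - b2)) = (a1 - a2) + (a1 - a2)"
      "((a1 - b1) + (b2 - a2)) - ((b1 - a2) + (a1 - b2)) = (b2 - b1) + (b2 - b1)"
      by (simp_all add: algebra_simps)
    then have xy: "x + y = a1 - a2" "x - y = b2 - b1"
      by (simp_all only: x_def y_def scaleR_half_double flip: scaleR_add_right scaleR_diff_right)
    show ?thesis
      using par[of x y] avg[of "a1 - b1" "b2 - a2"] avg[of "b1 - a2" "a1 - b2"]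
      unfolding xy x_def[symmetric] y_def[symmetric] dist_norm
      by (simp add: norm_minus_commute)
  qed
  then show ?thesis using p by (simp add: has_roundness_def)
qed

lemma has_roundness_parallelogram:
  assumes "has_roundness TYPE('a::real_normed_vector) p"
  shows "norm (x + y :: 'a) powr p + norm (x - y) powr p
      \<le> 2 * norm x powr p + 2 * norm y powr p"
proof -
  have "dist (x + y) 0 powr p + dist x y powr p
      \<le> dist (x + y) x powr p + dist (x + y) y powr p + dist 0 x powr p + dist 0 y powr p"
    using assms unfolding has_roundness_def by blast
  then show ?thesis by (simp add: dist_norm)
qed

lemma has_roundness_1: "has_roundness TYPE('a::metric_space) 1"
proof -
  have "dist a1 a2 + dist b1 b2 \<le> dist a1 b1 + dist a1 b2 + dist a2 b1 + dist a2 b2"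
    for a1 a2 b1 b2 :: 'a
    using dist_triangle[of a1 a2 b1] dist_triangle[of a1 a2 b2]
      dist_triangle[of b1 b2 a1] dist_triangle[of b1 b2 a2]
    by (simp add: dist_commute)
  then show ?thesis by (simp add: has_roundness_def)
qed

section \<open>Smooth spaces have roundness above one\<close>

lemma powr_le_tangent_at_1:
  fixes z q :: real
  assumes "0 \<le> z" "0 \<le> q" "q \<le> 1"
  shows "z powr q \<le> 1 + q * (z - 1)"
proof (cases "z = 0")
  case False
  then show ?thesis
    using Youngs_inequality_0[of q "1 - q" z 1] assms by (simp add: algebra_simps)
qed (use assms in simp)

text \<open>This isolates the choice of the exponent from the geometry: \<open>A\<close>, \<open>B\<close> and \<open>t\<close> stand for the
  norms of \<open>x + y\<close>, \<open>x - y\<close> and \<open>y\<close>, where \<open>x\<close> is a unit vector. The quadratic bound settles the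
  range \<open>t \<le> \<delta>\<close> for every \<open>p \<le> 3/2\<close>. On the remaining range \<open>\<delta> \<le> t \<le> 1\<close> the linear bound leaves the
  margin \<open>t / C \<ge> 6 * \<eta>\<close>. As \<open>p\<close> tends to 1, the factors \<open>2 powr (p - 1)\<close> and \<open>\<delta> powr (p - 1)\<close>, which
  measure the error of replacing \<open>p\<close>-th powers by first powers, tend to 1 and use up less than this
  margin.\<close>

lemma exists_roundness_exponent:
  fixes C :: real
  assumes C: "1 \<le> C"
  obtains p where "1 < p"
    and "\<And>A B t. 0 \<le> A \<Longrightarrow> 0 \<le> B \<Longrightarrow> A \<le> 2 \<Longrightarrow> B \<le> 2 \<Longrightarrow> 0 \<le> t \<Longrightarrow> t \<le> 1
      \<Longrightarrow> A\<^sup>2 + B\<^sup>2 \<le> 2 + 2 * C * t\<^sup>2 \<Longrightarrow> A + B \<le> 2 + 2 * (1 - 1 / (2 * C)) * t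
      \<Longrightarrow> A powr p + B powr p \<le> 2 + 2 * t powr p"
proof -
  define \<delta> where "\<delta> = 1 / C\<^sup>2"
  define \<eta> where "\<eta> = \<delta> / (6 * C)"
  have \<delta>: "0 < \<delta>" "\<delta> \<le> 1" and \<eta>: "0 < \<eta>"
    using C by (auto simp: \<delta>_def \<eta>_def)
  have "((\<lambda>p. 2 powr (p - 1)) \<longlongrightarrow> 2 powr (1 - 1)) (at_right (1::real))"
    "((\<lambda>p. \<delta> powr (p - 1)) \<longlongrightarrow> \<delta> powr (1 - 1)) (at_right (1::real))"
    by (intro tendsto_intros; use \<delta> in simp)+
  then have "eventually (\<lambda>p. 2 powr (p - 1) < 1 + \<eta>) (at_right (1::real))"
    "eventually (\<lambda>p. \<delta> powr (p - 1) > 1 - \<eta>) (at_right (1::real))"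
    using \<delta> \<eta> by (auto dest: order_tendstoD(2)[of _ _ _ "1 + \<eta>"] order_tendstoD(1)[of _ _ _ "1 - \<eta>"])
  moreover have "eventually (\<lambda>p. 1 < p \<and> p < 3 / 2) (at_right (1::real))"
    using eventually_at_right_real[of 1 "3 / 2 :: real"] by (auto elim: eventually_mono)
  ultimately have "eventually (\<lambda>p. 2 powr (p - 1) < 1 + \<eta> \<and> \<delta> powr (p - 1) > 1 - \<eta>
      \<and> 1 < p \<and> p < 3 / 2) (at_right (1::real))"
    by eventually_elim auto
  then obtain p :: real where p: "2 powr (p - 1) < 1 + \<eta>" "\<delta> powr (p - 1) > 1 - \<eta>"
      "1 < p" "p < 3 / 2"
    using eventually_happens'[OF trivial_limit_at_right_real] by blast
  show thesis
  proof (rule that[OF p(3)])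
    fix A B t :: real
    assume A: "0 \<le> A" "A \<le> 2" and B: "0 \<le> B" "B \<le> 2" and t: "0 \<le> t" "t \<le> 1"
      and sq: "A\<^sup>2 + B\<^sup>2 \<le> 2 + 2 * C * t\<^sup>2"
      and lin: "A + B \<le> 2 + 2 * (1 - 1 / (2 * C)) * t"
    show "A powr p + B powr p \<le> 2 + 2 * t powr p"
    proof (cases "t \<le> \<delta>")
      case True
      have power_le: "Z powr p \<le> 1 + p / 2 * (Z\<^sup>2 - 1)" if "0 \<le> Z" for Z
      proof -
        have "Z powr p = (Z\<^sup>2) powr (p / 2)"
          using that by (simp add: powr_powr flip: powr_numeral)
        then show ?thesis
          using powr_le_tangent_at_1[of "Z\<^sup>2" "p / 2"] p by simp
      qed
      have "A powr p + B powr p \<le> 2 + p / 2 * (A\<^sup>2 + B\<^sup>2 - 2)"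
        using power_le[OF A(1)] power_le[OF B(1)] by (simp add: algebra_simps)
      also have "\<dots> \<le> 2 + p / 2 * (2 * C * t\<^sup>2)"
        using sq p by simp
      also have "\<dots> \<le> 2 + 1 * (2 * C * t\<^sup>2)"
        using p C by (intro add_left_mono mult_right_mono) auto
      also have "\<dots> = 2 + 2 * (C * t\<^sup>2)" by simp
      also have "C * t\<^sup>2 \<le> t powr p"
      proof -
        have "t powr (2 - p) \<le> t powr (1 / 2)"
          using t p by (intro powr_mono') auto
        also have "\<dots> \<le> \<delta> powr (1 / 2)"
          using t True by (intro powr_mono2) auto
        also have "\<dots> = 1 / C"
          using C by (simp add: \<delta>_def powr_half_sqrt real_sqrt_divide)
        finally have "C * t powr (2 - p) \<le> 1"
          using C by (simp add: field_simps)
        then have "t powr p * (C * t powr (2 - p)) \<le> t powr p * 1"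
          by (intro mult_left_mono) auto
        moreover have "t powr p * t powr (2 - p) = t\<^sup>2"
          using t by (simp add: powr_numeral flip: powr_add)
        ultimately show ?thesis by (simp add: mult.left_commute)
      qed
      finally show ?thesis by simp
    next
      case False
      have power_le: "Z powr p \<le> (1 + \<eta>) * Z" if "0 \<le> Z" "Z \<le> 2" for Z
      proof -
        have "Z powr p = Z powr (p - 1) * Z"
          using that by (cases "Z = 0") (auto simp: powr_diff)
        also have "Z powr (p - 1) \<le> 2 powr (p - 1)"
          using that p by (intro powr_mono2) auto
        finally show ?thesis
          using p that by (smt (verit) mult_right_mono)
      qed
      have "A powr p + B powr p \<le> (1 + \<eta>) * (A + B)"
        using power_le[OF A] power_le[OF B] by (simp add: algebra_simps)
      also have "\<dots> \<le> (1 + \<eta>) * (2 + 2 * (1 - 1 / (2 * C)) * t)"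
        using lin \<eta> by (intro mult_left_mono) auto
      also have "\<dots> = 2 + 2 * t - t / C + \<eta> * (2 + 2 * t - t / C)"
        using C by (simp add: field_simps)
      also have "\<dots> \<le> 2 + 2 * t - 6 * \<eta> + \<eta> * 4"
      proof -
        have "6 * \<eta> \<le> t / C"
          using False C by (simp add: \<eta>_def divide_right_mono)
        moreover have "0 \<le> t / C" using t C by simp
        then have "\<eta> * (2 + 2 * t - t / C) \<le> \<eta> * 4"
          using \<eta> t by (intro mult_left_mono) linarith+
        ultimately show ?thesis by linarith
      qed
      also have "\<dots> \<le> 2 + 2 * ((1 - \<eta>) * t)"
        using mult_left_mono[OF t(2), of \<eta>] \<eta> by (simp add: algebra_simps)
      also have "(1 - \<eta>) * t \<le> t powr (p - 1) * t"
      proof (rule mult_right_mono)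
        have "\<delta> powr (p - 1) \<le> t powr (p - 1)"
          using False \<delta> p by (intro powr_mono2) auto
        then show "1 - \<eta> \<le> t powr (p - 1)" using p by linarith
      qed (use t in simp)
      also have "t powr (p - 1) * t = t powr p"
        using t by (cases "t = 0") (auto simp: powr_diff)
      finally show ?thesis by simp
    qed
  qed
qed

text \<open>Moving from \<open>x\<close> only to \<open>x \<plusminus> y / C\<close> costs a second-order term by smoothness, and the triangle
  inequality pays for the rest of the way to \<open>x \<plusminus> y\<close>. The step \<open>1 / C\<close> minimises the worst case
  \<open>1 - \<epsilon> + C * \<epsilon>\<^sup>2 / 2\<close> of the excess, attained at \<open>norm y = 1\<close>, over the step sizes \<open>\<epsilon>\<close>.\<close>

lemma two_smooth_imp_nonsquare:
  fixes x y :: "'a::real_normed_vector"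
  assumes C: "1 \<le> C"
    and smooth: "\<And>x y :: 'a. (norm (x + y))\<^sup>2 + (norm (x - y))\<^sup>2 \<le> 2 * (norm x)\<^sup>2 + 2 * C * (norm y)\<^sup>2"
    and x: "norm x = 1" and y: "norm y \<le> 1"
  shows "norm (x + y) + norm (x - y) \<le> 2 + 2 * (1 - 1 / (2 * C)) * norm y"
proof -
  define z where "z = (1 / C) *\<^sub>R y"
  define w where "w = (1 - 1 / C) *\<^sub>R y"
  have zw: "z + w = y"
    by (simp add: z_def w_def flip: scaleR_add_left)
  have z: "norm z = norm y / C" and w: "norm w = (1 - 1 / C) * norm y"
    using C by (simp_all add: z_def w_def)
  have "norm (x + z) + norm (x - z) \<le> (1 + (norm (x + z))\<^sup>2) / 2 + (1 + (norm (x - z))\<^sup>2) / 2"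
    using sum_squares_bound[of 1 "norm (x + z)", simplified]
      sum_squares_bound[of 1 "norm (x - z)", simplified] by argo
  also have "\<dots> \<le> 2 + C * (norm z)\<^sup>2"
    using smooth[of x z] x by (simp add: field_simps)
  also have "C * (norm z)\<^sup>2 = norm y * norm y / C"
    using C by (simp add: z power2_eq_square field_simps)
  also have "\<dots> \<le> norm y * 1 / C"
    using y C by (intro divide_right_mono mult_left_mono) auto
  finally have "norm (x + z) + norm (x - z) \<le> 2 + norm y / C" by simp
  moreover have "norm (x + y) \<le> norm (x + z) + norm w"
    using norm_triangle_ineq[of "x + z" w] by (simp add: zw add.assoc)
  moreover have "norm (x - y) \<le> norm (x - z) + norm w"
    using norm_triangle_ineq4[of "x - z" w] by (simp add: zw[symmetric] diff_diff_eq)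
  ultimately show ?thesis
    using C by (simp add: w field_simps)
qed

theorem two_smooth_imp_roundness_above_1:
  fixes C :: real
  assumes C: "1 \<le> C"
    and smooth: "\<And>x y :: 'a::real_normed_vector.
      (norm (x + y))\<^sup>2 + (norm (x - y))\<^sup>2 \<le> 2 * (norm x)\<^sup>2 + 2 * C * (norm y)\<^sup>2"
  shows "\<exists>p>1. has_roundness TYPE('a) p"
proof -
  obtain p where p: "1 < p"
    and key: "\<And>A B t. 0 \<le> A \<Longrightarrow> 0 \<le> B \<Longrightarrow> A \<le> 2 \<Longrightarrow> B \<le> 2 \<Longrightarrow> 0 \<le> t \<Longrightarrow> t \<le> 1
      \<Longrightarrow> A\<^sup>2 + B\<^sup>2 \<le> 2 + 2 * C * t\<^sup>2 \<Longrightarrow> A + B \<le> 2 + 2 * (1 - 1 / (2 * C)) * t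
      \<Longrightarrow> A powr p + B powr p \<le> 2 + 2 * t powr p"
    using exists_roundness_exponent[OF C] by metis
  have unit: "norm (x + y) powr p + norm (x - y) powr p \<le> 2 + 2 * norm y powr p"
    if "norm x = 1" "norm y \<le> 1" for x y :: 'a
    using that norm_triangle_ineq[of x y] norm_triangle_ineq4[of x y] smooth[of x y]
    by (intro key two_smooth_imp_nonsquare[OF C smooth]) auto
  have le: "norm (x + y) powr p + norm (x - y) powr p \<le> 2 * norm x powr p + 2 * norm y powr p"
    if yx: "norm y \<le> norm x" for x y :: 'a
  proof (cases "x = 0")
    case False
    let ?n = "norm x"
    have n: "?n > 0" using False by simp
    have "norm (x /\<^sub>R ?n + y /\<^sub>R ?n) powr p + norm (x /\<^sub>R ?n - y /\<^sub>R ?n) powr p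
        \<le> 2 + 2 * norm (y /\<^sub>R ?n) powr p"
      using n yx by (intro unit) (auto simp: field_simps)
    also have "x /\<^sub>R ?n + y /\<^sub>R ?n = (x + y) /\<^sub>R ?n" by (simp add: scaleR_add_right)
    also have "x /\<^sub>R ?n - y /\<^sub>R ?n = (x - y) /\<^sub>R ?n" by (simp add: scaleR_diff_right)
    finally have "norm (x + y) powr p / ?n powr p + norm (x - y) powr p / ?n powr p
        \<le> 2 + 2 * (norm y powr p / ?n powr p)"
      using n by (simp add: powr_divide divide_inverse_commute[symmetric])
    moreover have "?n powr p > 0" using n by simp
    moreover have "u + v \<le> 2 * m + 2 * w" if "u / m + v / m \<le> 2 + 2 * (w / m)" "m > 0"
      for u v w m :: real
      using that mult_right_mono[of "u / m + v / m" "2 + 2 * (w / m)" m] by (simp add: distrib_right)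
    ultimately show ?thesis by blast
  qed (use yx in simp)
  have "norm (x + y) powr p + norm (x - y) powr p \<le> 2 * norm x powr p + 2 * norm y powr p"
    for x y :: 'a
    using le[of x y] le[of y x]
    by (cases "norm y \<le> norm x") (auto simp: add.commute norm_minus_commute)
  then have "has_roundness TYPE('a) p"
    using p by (intro has_roundness_if_parallelogram) auto
  with p show ?thesis by blast
qed

section \<open>Smoothness of the racetrack norm\<close>

lemma racetrack_norm_power2_leI:
  assumes "s\<^sup>2 \<le> u" "(x - s)\<^sup>2 + y\<^sup>2 \<le> u"
  shows "(racetrack_norm x y)\<^sup>2 \<le> u"
proof -
  have u: "0 \<le> u" using assms(1) zero_le_power2[of s] by linarith
  have "racetrack_norm x y \<le> sqrt u"
    using assms by (intro racetrack_norm_leI[where s = s]) (auto intro: real_le_rsqrt)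
  then show ?thesis
    using racetrack_norm_nonneg[of x y] u power_mono[of "racetrack_norm x y" "sqrt u" 2] by simp
qed

lemma power2_diff_le: "(u - v)\<^sup>2 \<le> 2 * u\<^sup>2 + 2 * v\<^sup>2" for u v :: real
  using zero_le_power2[of "u + v"] by (simp add: power2_eq_square algebra_simps)

text \<open>The norm of \<open>v\<close> is at most \<open>u\<close> as soon as \<open>v\<close> lies within Euclidean distance \<open>u\<close> of some point
  \<open>(s, 0)\<close> with \<open>\<bar>s\<bar> \<le> u\<close>. An upper bound near \<open>(a, b)\<close> therefore only needs a centre \<open>(s, 0)\<close> for each
  perturbed point, and a centre depending linearly on the perturbation is enough. If
  \<open>\<bar>a\<bar> \<le> \<bar>b\<bar>\<close>, the norm is locally governed by the second coordinate, and the centre is scaled with it.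
  Otherwise the centre that is optimal for \<open>(a, b)\<close> moves by the derivative \<open>l\<close> of the signed norm
  \<open>m = (a\<^sup>2 + b\<^sup>2) / (2 * a)\<close>. This makes the first-order terms of both constraints agree.\<close>

lemma racetrack_norm_quadratic_bound:
  obtains \<alpha> \<beta> where
    "\<And>h k. (racetrack_norm (a + h) (b + k))\<^sup>2
      \<le> (racetrack_norm a b)\<^sup>2 + (\<alpha> * h + \<beta> * k) + 5 * (h\<^sup>2 + k\<^sup>2)"
proof (cases "\<bar>a\<bar> \<le> \<bar>b\<bar>")
  case True
  define c where "c = a / b"
  have a: "a = c * b" using True by (auto simp: c_def)
  have c: "\<bar>c\<bar> \<le> 1" using True by (cases "b = 0") (auto simp: c_def)
  then have c2: "c\<^sup>2 \<le> 1" by (simp add: abs_square_le_1)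
  have n: "racetrack_norm a b = \<bar>b\<bar>" using True by (simp add: racetrack_norm_def)
  show thesis
  proof (rule that[of 0 "2 * b"])
    fix h k
    have ck: "(c * z)\<^sup>2 \<le> z\<^sup>2" for z
      using mult_right_mono[OF c2, of "z\<^sup>2"] by (simp add: power_mult_distrib)
    have "(racetrack_norm (a + h) (b + k))\<^sup>2 \<le> (b + k)\<^sup>2 + (h - c * k)\<^sup>2"
    proof (rule racetrack_norm_power2_leI[where s = "c * (b + k)"])
      show "(c * (b + k))\<^sup>2 \<le> (b + k)\<^sup>2 + (h - c * k)\<^sup>2"
        using ck[of "b + k"] zero_le_power2[of "h - c * k"] by linarith
      have shift: "a + h - c * (b + k) = h - c * k" by (simp add: a algebra_simps)
      show "(a + h - c * (b + k))\<^sup>2 + (b + k)\<^sup>2 \<le> (b + k)\<^sup>2 + (h - c * k)\<^sup>2"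
        unfolding shift by simp
    qed
    moreover have "(h - c * k)\<^sup>2 \<le> 2 * h\<^sup>2 + 2 * k\<^sup>2"
      using power2_diff_le[of h "c * k"] ck[of k] by linarith
    moreover have "(b + k)\<^sup>2 = \<bar>b\<bar>\<^sup>2 + 2 * b * k + k\<^sup>2" by (simp add: power2_sum)
    ultimately show "(racetrack_norm (a + h) (b + k))\<^sup>2
        \<le> (racetrack_norm a b)\<^sup>2 + (0 * h + 2 * b * k) + 5 * (h\<^sup>2 + k\<^sup>2)"
      using zero_le_power2[of h] zero_le_power2[of k] unfolding n distrib_left by linarith
  qed
next
  case False
  then have a0: "a \<noteq> 0" by auto
  define r where "r = b / a"
  define m where "m = a * (1 + r\<^sup>2) / 2"
  have b: "b = r * a" using a0 by (simp add: r_def)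
  have r: "r\<^sup>2 \<le> 1"
    using False a0 by (simp add: r_def power_divide abs_le_square_iff[symmetric])
  have n: "(racetrack_norm a b)\<^sup>2 = m\<^sup>2"
    using False a0 by (simp add: racetrack_norm_def m_def b power_divide power_mult_distrib)
      (simp add: power2_eq_square field_simps)
  show thesis
  proof (rule that[of "2 * m * ((1 - r\<^sup>2) / 2)" "2 * m * r"])
    fix h k
    define l where "l = (1 - r\<^sup>2) / 2 * h + r * k"
    \<comment> \<open>Cauchy-Schwarz; the gradient of \<open>m\<close> has Euclidean length \<open>(1 + r\<^sup>2) / 2 \<le> 1\<close>.\<close>
    have l: "l\<^sup>2 \<le> h\<^sup>2 + k\<^sup>2"
    proof -
      have "l\<^sup>2 \<le> l\<^sup>2 + ((1 - r\<^sup>2) / 2 * k - r * h)\<^sup>2" by simp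
      also have "\<dots> = ((1 + r\<^sup>2) / 2)\<^sup>2 * (h\<^sup>2 + k\<^sup>2)"
        by (simp add: l_def power2_eq_square field_simps)
      also have "\<dots> \<le> 1 * (h\<^sup>2 + k\<^sup>2)"
        using r by (intro mult_right_mono power_le_one) auto
      finally show ?thesis by simp
    qed
    have "(racetrack_norm (a + h) (b + k))\<^sup>2 \<le> m\<^sup>2 + 2 * m * l + (l\<^sup>2 + (h - l)\<^sup>2 + k\<^sup>2)"
    proof (rule racetrack_norm_power2_leI[where s = "m + l"])
      show "(m + l)\<^sup>2 \<le> m\<^sup>2 + 2 * m * l + (l\<^sup>2 + (h - l)\<^sup>2 + k\<^sup>2)"
        by (simp add: power2_sum)
      have "(a + h - (m + l))\<^sup>2 + (b + k)\<^sup>2 = m\<^sup>2 + 2 * m * l + ((h - l)\<^sup>2 + k\<^sup>2)"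
        by (simp add: b m_def l_def power2_eq_square field_simps)
      then show "(a + h - (m + l))\<^sup>2 + (b + k)\<^sup>2 \<le> m\<^sup>2 + 2 * m * l + (l\<^sup>2 + (h - l)\<^sup>2 + k\<^sup>2)"
        by simp
    qed
    also have "l\<^sup>2 + (h - l)\<^sup>2 + k\<^sup>2 \<le> 5 * (h\<^sup>2 + k\<^sup>2)"
      using power2_diff_le[of h l] l zero_le_power2[of k] unfolding distrib_left by linarith
    finally show "(racetrack_norm (a + h) (b + k))\<^sup>2 \<le> (racetrack_norm a b)\<^sup>2
        + (2 * m * ((1 - r\<^sup>2) / 2) * h + 2 * m * r * k) + 5 * (h\<^sup>2 + k\<^sup>2)"
      unfolding n by (simp add: l_def algebra_simps)
  qed
qed

text \<open>The linear terms of the quadratic bounds at \<open>x + y\<close> and \<open>x - y\<close> cancel. The constant is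
  \<open>5 * 2\<^sup>2\<close>, because the Euclidean norm is at most twice the racetrack norm.\<close>

lemma racetrack_two_smooth:
  fixes x y :: racetrack
  shows "(norm (x + y))\<^sup>2 + (norm (x - y))\<^sup>2 \<le> 2 * (norm x)\<^sup>2 + 2 * 20 * (norm y)\<^sup>2"
proof -
  define a b h k where "a = coords x $ 1" "b = coords x $ 2" "h = coords y $ 1" "k = coords y $ 2"
  note defs = this
  obtain \<alpha> \<beta> where bound: "\<And>h k. (racetrack_norm (a + h) (b + k))\<^sup>2
      \<le> (racetrack_norm a b)\<^sup>2 + (\<alpha> * h + \<beta> * k) + 5 * (h\<^sup>2 + k\<^sup>2)"
    using racetrack_norm_quadratic_bound[of a b] by blast
  have norms: "norm (x + y) = racetrack_norm (a + h) (b + k)"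
    "norm (x - y) = racetrack_norm (a + - h) (b + - k)" "norm x = racetrack_norm a b"
    by (simp_all add: norm_racetrack.rep_eq plus_racetrack.rep_eq minus_racetrack.rep_eq defs)
  have "h\<^sup>2 + k\<^sup>2 = (norm (coords y))\<^sup>2"
    by (simp add: norm_vec_def L2_set_def sum_2 defs)
  also have "\<dots> \<le> (2 * norm y)\<^sup>2"
    by (intro power_mono norm_coords_le) simp
  finally have "h\<^sup>2 + k\<^sup>2 \<le> 4 * (norm y)\<^sup>2" by (simp add: power_mult_distrib)
  then show ?thesis
    using bound[of h k] bound[of "- h" "- k"] unfolding norms by simp
qed

section \<open>The dual of the racetrack space\<close>

definition functional :: "real \<Rightarrow> real \<Rightarrow> racetrack_dual" where
  "functional \<alpha> \<beta> = Blinfun (\<lambda>v. \<alpha> * coords v $ 1 + \<beta> * coords v $ 2)"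

lemma functional_apply: "functional \<alpha> \<beta> v = \<alpha> * coords v $ 1 + \<beta> * coords v $ 2"
proof -
  have comp: "\<bar>coords w $ i\<bar> \<le> norm w * 2" for w i
    using component_le_norm_cart[of "coords w" i] norm_coords_le[of w] by linarith
  have "bounded_linear (\<lambda>v. coords v $ i)" for i
    by (rule bounded_linear_intro[where K = 2])
      (simp_all add: plus_racetrack.rep_eq scaleR_racetrack.rep_eq comp)
  then have "bounded_linear (\<lambda>v. \<alpha> * coords v $ 1 + \<beta> * coords v $ 2)"
    by (intro bounded_linear_add bounded_linear_const_mult)
  then show ?thesis by (simp add: functional_def bounded_linear_Blinfun_apply)
qed

lemma functional_add: "functional \<alpha> \<beta> + functional \<alpha>' \<beta>' = functional (\<alpha> + \<alpha>') (\<beta> + \<beta>')"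
  and functional_diff: "functional \<alpha> \<beta> - functional \<alpha>' \<beta>' = functional (\<alpha> - \<alpha>') (\<beta> - \<beta>')"
  by (rule blinfun_eqI, simp add: functional_apply blinfun.add_left blinfun.diff_left algebra_simps)+

lemma norm_functional_0_1: "norm (functional 0 1) \<le> 1"
proof (rule norm_blinfun_bound)
  fix v :: racetrack
  have "\<bar>y\<bar> \<le> racetrack_norm x y" for x y
  proof -
    obtain s where "sqrt ((x - s)\<^sup>2 + y\<^sup>2) \<le> racetrack_norm x y"
      using racetrack_norm_witness by blast
    then show ?thesis using real_sqrt_sum_squares_ge2[of y "x - s"]
      by (smt (verit) real_sqrt_abs real_sqrt_le_mono zero_le_power2)
  qed
  then show "norm (functional 0 1 v) \<le> 1 * norm v"
    by (simp add: functional_apply norm_racetrack.rep_eq)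
qed simp

lemma norm_functional_0:
  assumes "0 \<le> \<epsilon>"
  shows "norm (functional \<epsilon> 0) \<le> 2 * \<epsilon>"
proof (rule norm_blinfun_bound)
  fix v :: racetrack
  have "\<bar>coords v $ 1\<bar> \<le> 2 * norm v"
    using component_le_norm_cart[of "coords v" 1] norm_coords_le[of v] by linarith
  then have "\<epsilon> * \<bar>coords v $ 1\<bar> \<le> \<epsilon> * (2 * norm v)"
    using assms by (intro mult_left_mono)
  then show "norm (functional \<epsilon> 0 v) \<le> 2 * \<epsilon> * norm v"
    using assms by (simp add: functional_apply abs_mult mult_ac)
qed (use assms in simp)

text \<open>Evaluation at the four points \<open>(\<plusminus>1, \<plusminus>1)\<close>, which lie on the racetrack where the straight and
  the curved parts meet.\<close>

lemma norm_functional_ge: "\<bar>\<alpha>\<bar> + \<bar>\<beta>\<bar> \<le> norm (functional \<alpha> \<beta>)"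
proof -
  define v where "v = of_coords (vector [if \<alpha> < 0 then - 1 else 1, if \<beta> < 0 then - 1 else 1])"
  have coords: "coords v $ 1 = (if \<alpha> < 0 then - 1 else 1)" "coords v $ 2 = (if \<beta> < 0 then - 1 else 1)"
    by (simp_all add: v_def of_coords_inverse)
  then have "norm v = 1" by (simp add: norm_racetrack.rep_eq racetrack_norm_def)
  then show ?thesis
    using norm_blinfun[of "functional \<alpha> \<beta>" v] by (auto simp: functional_apply coords split: if_splits)
qed

text \<open>The parallelogram spanned by the functionals \<open>(0, 1)\<close> and \<open>(u / 2, 0)\<close> violates roundness \<open>p\<close>
  once \<open>1 + u / 2 > 1 + u powr p\<close>, that is, once \<open>u powr (p - 1) < 1 / 2\<close>.\<close>

lemma racetrack_dual_roundness_le_1: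
  assumes "has_roundness TYPE(racetrack_dual) p"
  shows "p \<le> 1"
proof (rule ccontr)
  assume "\<not> p \<le> 1"
  then have p: "1 < p" by simp
  define u where "u = (1 / 4 :: real) powr (1 / (p - 1))"
  have u: "0 < u" by (simp add: u_def)
  have "u powr p = u powr (p - 1) * u"
    using u by (simp add: powr_diff)
  also have "u powr (p - 1) = 1 / 4"
    using p by (simp add: u_def powr_powr)
  finally have up: "u powr p = u / 4" by simp
  have pow: "1 + u / 2 \<le> norm f powr p" if "1 + u / 2 \<le> norm f" for f :: racetrack_dual
  proof -
    have "1 + u / 2 \<le> (1 + u / 2) powr p"
      using powr_mono[of 1 p "1 + u / 2"] p u by simp
    also have "\<dots> \<le> norm f powr p"
      using that p u by (intro powr_mono2) auto
    finally show ?thesis .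
  qed
  have "1 + u / 2 \<le> norm (functional 0 1 + functional (u / 2) 0) powr p"
    "1 + u / 2 \<le> norm (functional 0 1 - functional (u / 2) 0) powr p"
    using norm_functional_ge[of "u / 2" 1] norm_functional_ge[of "- (u / 2)" 1] u
    by (intro pow; simp add: functional_add functional_diff)+
  moreover have "norm (functional 0 1) powr p \<le> 1 powr p"
    using norm_functional_0_1 p by (intro powr_mono2) auto
  moreover have "norm (functional (u / 2) 0) powr p \<le> u powr p"
    using norm_functional_0[of "u / 2"] p u by (intro powr_mono2) auto
  ultimately show False
    using has_roundness_parallelogram[OF assms, of "functional 0 1" "functional (u / 2) 0"] up u
    by simp
qed

section \<open>Maximal roundness of the racetrack space and of its dual\<close>

theorem corollary6p11:
  shows "max_roundness TYPE(racetrack) > 1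
       \<and> max_roundness TYPE(racetrack_dual) = 1
       \<and> max_roundness TYPE(racetrack) \<noteq> max_roundness TYPE(racetrack_dual)"
proof -
  obtain p where p: "1 < p" "has_roundness TYPE(racetrack) p"
    using two_smooth_imp_roundness_above_1[of 20, OF _ racetrack_two_smooth] by auto
  have "1 < ereal p" using p(1) by simp
  also have "\<dots> \<le> max_roundness TYPE(racetrack)"
    unfolding max_roundness_def using p(2) by (intro SUP_upper) simp
  finally have R: "1 < max_roundness TYPE(racetrack)" .
  have one_le: "1 \<le> q" if "has_roundness TYPE(racetrack_dual) q" for q
    using that by (simp add: has_roundness_def)
  have "{p. has_roundness TYPE(racetrack_dual) p} = {1}"
    using racetrack_dual_roundness_le_1 has_roundness_1 by (auto intro: antisym simp: one_le)
  then have "max_roundness TYPE(racetrack_dual) = 1"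
    by (simp add: max_roundness_def one_ereal_def)
  with R show ?thesis by auto
qed

end
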